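(* Let $M\in\mathbb{R}^{n\times n}$ have constant column sums $\lambda$ (every column of $M$ has sum $\lambda$), so that $\lambda$ is an eigenvalue of $M$. Assume the geometric multiplicity of $\lambda$ is $1$, and a corresponding eigenvector $v\in\mathbb{R}^n$ of $M$ satisfies $v_i+v_j\neq 0$ for all $i$ and $j$, including $i=j$. Then an $M$-invariant polydiagonal subspace $\Delta_{\mathcal{P}}$ of $\mathbb{R}^n$ is either a synchrony subspace that contains $v$ or an evenly tagged anti-synchrony subspace that does not contain $v$.
   Context: A subspace $V\subseteq\mathbb{R}^n$ is $M$-invariant if $MV\subseteq V$. A partial involution on a set $X$ is a map $x\mapsto x^*:\tilde X\to\tilde X$ defined on a (possibly empty) subset $\tilde X\subseteq X$ that is its own inverse. A tagged partition of a finite set $C$ is a partition $\mathcal{P}$ of $C$ (into nonempty classes) together with a partial involution $P\mapsto P^*$ on $\mathcal{P}$ that has at most one fixed point. The class of $i$ is denoted by $[i]$. For a tagged partition $\mathcal{P}$ of $\{1,\ldots,n\}$, the polydiagonal subspace is $$\Delta_{\mathcal{P}}=\{x\in\mathbb{R}^n\mid x_i=x_j\text{ if }[i]=[j],\text{ and }x_i=-x_j\text{ if }[i]^*=[j]\}.$$ Distinct tagged partitions give distinct polydiagonal subspaces. $\Delta_{\mathcal{P}}$ is a synchrony subspace if the partial involution is the empty function, and an anti-synchrony subspace if it is not the empty function. $\Delta_{\mathcal{P}}$ is fully tagged if the partial involution is defined on all of $\mathcal{P}$, and evenly tagged if it is fully tagged and $\#P=\#P^*$ for all $P\in\mathcal{P}$.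 *)

theory Defs
  imports "HOL-Analysis.Analysis"
begin

definition partial_involution_on :: "'a set \<Rightarrow> ('a \<rightharpoonup> 'a) \<Rightarrow> bool" where
  "partial_involution_on X t \<longleftrightarrow>
     dom t \<subseteq> X \<and> (\<forall>x y. t x = Some y \<longrightarrow> t y = Some x)"

definition tagged_partition :: "'a set \<Rightarrow> 'a set set \<Rightarrow> ('a set \<rightharpoonup> 'a set) \<Rightarrow> bool" where
  "tagged_partition C P t \<longleftrightarrow>
     partition_on C P \<and> partial_involution_on P t \<and>
     (\<forall>A B. t A = Some A \<and> t B = Some B \<longrightarrow> A = B)"

definition class_of :: "'a set set \<Rightarrow> 'a \<Rightarrow> 'a set" where
  "class_of P i = (THE A. A \<in> P \<and> i \<in> A)"

definition polydiagonal :: "'n set set \<Rightarrow> ('n set \<rightharpoonup> 'n set) \<Rightarrow> (real ^ 'n) set" where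
  "polydiagonal P t = {x. \<forall>i j.
     (class_of P i = class_of P j \<longrightarrow> x $ i = x $ j) \<and>
     (t (class_of P i) = Some (class_of P j) \<longrightarrow> x $ i = - (x $ j))}"

text \<open>The subspace \<^term>\<open>polydiagonal P t\<close> determines the tagged partition \<open>(P, t)\<close>, so
  properties of the subspace that refer to the tagging are predicates on \<open>(P, t)\<close>.\<close>

definition synchrony :: "'n set set \<Rightarrow> ('n set \<rightharpoonup> 'n set) \<Rightarrow> bool" where
  "synchrony P t \<longleftrightarrow> t = Map.empty"

definition anti_synchrony :: "'n set set \<Rightarrow> ('n set \<rightharpoonup> 'n set) \<Rightarrow> bool" where
  "anti_synchrony P t \<longleftrightarrow> t \<noteq> Map.empty"

definition fully_tagged :: "'n set set \<Rightarrow> ('n set \<rightharpoonup> 'n set) \<Rightarrow> bool" where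
  "fully_tagged P t \<longleftrightarrow> dom t = P"

definition evenly_tagged :: "'n set set \<Rightarrow> ('n set \<rightharpoonup> 'n set) \<Rightarrow> bool" where
  "evenly_tagged P t \<longleftrightarrow> fully_tagged P t \<and> (\<forall>A\<in>P. card A = card (the (t A)))"

definition invariant_under :: "real ^ 'n ^ 'n \<Rightarrow> (real ^ 'n) set \<Rightarrow> bool" where
  "invariant_under M V \<longleftrightarrow> (\<lambda>x. M *v x) ` V \<subseteq> V"

definition eigenspace :: "real ^ 'n ^ 'n \<Rightarrow> real \<Rightarrow> (real ^ 'n) set" where
  "eigenspace M l = {x. M *v x = l *\<^sub>R x}"

definition eigenvector :: "real ^ 'n ^ 'n \<Rightarrow> real ^ 'n \<Rightarrow> real \<Rightarrow> bool" where
  "eigenvector M v l \<longleftrightarrow> v \<noteq> 0 \<and> v \<in> eigenspace M l"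

definition geometric_multiplicity :: "real ^ 'n ^ 'n \<Rightarrow> real \<Rightarrow> nat" where
  "geometric_multiplicity M l = dim (eigenspace M l)"

end

theory Submission
  imports Defs
begin

text \<open>The row vector of ones is a left eigenvector, so \<open>M - \<lambda>I\<close> maps everything into the vectors with
  coordinate sum zero. If an invariant subspace \<open>W\<close> does not contain \<open>v\<close>, then \<open>M - \<lambda>I\<close> is injective
  on \<open>W\<close>, hence maps \<open>W\<close> onto itself, and all vectors of \<open>W\<close> have coordinate sum zero. For a
  polydiagonal subspace, testing this on the indicator vector of an untagged class and on the
  difference of the indicator vectors of two classes paired by the involution gives even tagging.\<close>

lemma class_of_eqI:
  assumes "partition_on C P" "A \<in> P" "i \<in> A"
  shows "class_of P i = A"
  unfolding class_of_def
proof (rule the_equality)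
  fix B assume "B \<in> P \<and> i \<in> B"
  with assms show "B = A"
    unfolding partition_on_def disjoint_def by blast
qed (use assms in blast)

text \<open>Used from right to left, this turns the membership conditions in indicator vectors into
  equations between classes, the language of \<open>polydiagonal\<close>.\<close>

lemma class_of_eq_iff:
  assumes "partition_on UNIV P" "A \<in> P"
  shows "class_of P i = A \<longleftrightarrow> i \<in> A"
proof -
  obtain B where "B \<in> P" "i \<in> B"
    using assms(1) unfolding partition_on_def by blast
  with class_of_eqI[OF assms(1)] assms(2) show ?thesis
    by metis
qed

lemma tagged_partition_partition_on: "tagged_partition C P t \<Longrightarrow> partition_on C P"
  by (simp only: tagged_partition_def)

lemma tagged_partition_sym: "tagged_partition C P t \<Longrightarrow> t A = Some B \<Longrightarrow> t B = Some A"
  unfolding tagged_partition_def partial_involution_on_def by blast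

lemma tagged_partition_mem:
  assumes "tagged_partition C P t" "t A = Some B"
  shows "A \<in> P" "B \<in> P"
  using assms tagged_partition_sym[OF assms]
  unfolding tagged_partition_def partial_involution_on_def by blast+

lemma subspace_polydiagonal:
  fixes P :: "'n::finite set set"
  shows "subspace (polydiagonal P t)"
proof -
  \<comment> \<open>As an intersection of solution sets of single homogeneous linear equations, the
    set is a subspace.\<close>
  have eq: "polydiagonal P t =
    (\<Inter>i. \<Inter>j\<in>{j. class_of P i = class_of P j}. {x. x $ i = x $ j}) \<inter>
    (\<Inter>i. \<Inter>j\<in>{j. t (class_of P i) = Some (class_of P j)}. {x. x $ i = - (x $ j)})"
    unfolding polydiagonal_def by blast
  have "subspace {x :: real ^ 'n. x $ i = x $ j}" "subspace {x :: real ^ 'n. x $ i = - (x $ j)}"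
    for i j :: 'n
    by (simp_all add: subspace_def)
  then show ?thesis
    unfolding eq by (intro subspace_inter subspace_Inter) (auto intro!: subspace_Inter)
qed

lemma subspace_eigenspace: "subspace (eigenspace M l)"
  by (simp add: subspace_def eigenspace_def matrix_vector_right_distrib scaleR_right_distrib
      matrix_vector_mult_scaleR)

lemma eigenspace_eq_span:
  assumes "geometric_multiplicity M l = 1" "eigenvector M v l"
  shows "eigenspace M l = span {v}"
proof -
  have "span {v} \<subseteq> eigenspace M l"
    using assms(2) by (intro span_minimal subspace_eigenspace) (simp add: eigenvector_def)
  moreover have "dim (eigenspace M l) \<le> dim (span {v})"
    using assms by (simp add: geometric_multiplicity_def eigenvector_def)
  ultimately show ?thesis
    using subspace_dim_equal[OF subspace_span subspace_eigenspace] by metis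
qed

lemma sum_matrix_vector_mult:
  fixes M :: "real ^ 'n ^ 'n"
  assumes "\<forall>j. (\<Sum>i\<in>UNIV. M $ i $ j) = l"
  shows "(\<Sum>i\<in>UNIV. (M *v x) $ i) = l * (\<Sum>i\<in>UNIV. x $ i)"
proof -
  have "(\<Sum>i\<in>UNIV. (M *v x) $ i) = (\<Sum>j\<in>UNIV. \<Sum>i\<in>UNIV. M $ i $ j * x $ j)"
    unfolding matrix_vector_mult_def vec_lambda_beta by (rule sum.swap)
  also have "\<dots> = l * (\<Sum>j\<in>UNIV. x $ j)"
    using assms by (simp add: sum_distrib_left flip: sum_distrib_right)
  finally show ?thesis .
qed

lemma invariant_subspace_sum_eq_0:
  fixes M :: "real ^ 'n ^ 'n"
  assumes cols: "\<forall>j. (\<Sum>i\<in>UNIV. M $ i $ j) = l"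
    and mult: "geometric_multiplicity M l = 1"
    and ev: "eigenvector M v l"
    and W: "subspace W" and inv: "invariant_under M W" and "v \<notin> W" and "x \<in> W"
  shows "(\<Sum>i\<in>UNIV. x $ i) = 0"
proof -
  define f where "f = (\<lambda>x. M *v x - l *\<^sub>R x)"
  have lin: "linear f"
    unfolding f_def by (intro linear_compose_sub matrix_vector_mul_linear linear_scale_self)
  \<comment> \<open>The kernel of \<open>f\<close> is the line through \<open>v\<close>, and a line
    not contained in \<open>W\<close> meets it only in 0.\<close>
  have "y = 0" if "y \<in> W" "f y = 0" for y
  proof (rule ccontr)
    assume "y \<noteq> 0"
    have "y \<in> span {v}"
      using that(2) eigenspace_eq_span[OF mult ev] by (auto simp: f_def eigenspace_def)
    then obtain c where c: "y = c *\<^sub>R v"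
      by (auto simp: span_singleton)
    with \<open>y \<noteq> 0\<close> have "v = inverse c *\<^sub>R y"
      by simp
    with subspace_scale[OF W that(1)] \<open>v \<notin> W\<close> show False
      by metis
  qed
  then have "inj_on f (span W)"
    using linear_inj_on_iff_eq_0[OF lin W] W by (simp add: span_eq_iff[THEN iffD2])
  \<comment> \<open>Injectivity preserves the dimension, so the image, lying in \<open>W\<close>, is
    all of \<open>W\<close>.\<close>
  then have "dim (f ` W) = dim W"
    by (rule dim_image_eq[OF lin])
  moreover have "f ` W \<subseteq> W"
    using inv W by (auto simp: f_def invariant_under_def intro!: subspace_diff subspace_scale)
  ultimately have "f ` W = W"
    using subspace_dim_equal linear_subspace_image[OF lin W] W by (metis order_refl)
  with \<open>x \<in> W\<close> obtain y where "x = f y"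
    by auto
  then show ?thesis
    using sum_matrix_vector_mult[OF cols, of y]
    by (simp add: f_def sum_subtractf flip: sum_distrib_left)
qed

lemma untagged_indicator_in_polydiagonal:
  fixes P :: "'n::finite set set"
  assumes "tagged_partition UNIV P t" "A \<in> P" "t A = None"
  shows "(\<chi> i. of_bool (i \<in> A)) \<in> polydiagonal P t"
proof -
  note iff = class_of_eq_iff[OF tagged_partition_partition_on[OF assms(1)] assms(2)]
  \<comment> \<open>Hence on any tagged pair of classes the indicator vanishes, and the sign
    condition reads 0 = -0.\<close>
  have "X \<noteq> A" "Y \<noteq> A" if "t X = Some Y" for X Y
    using tagged_partition_sym[OF assms(1) that] that assms(3) by auto
  then show ?thesis
    unfolding polydiagonal_def by (simp flip: iff)
qed

text \<open>The involution exchanges \<open>A\<close> and \<open>B\<close>, which flips the sign of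
  the vector. A fixed class \<open>A = B\<close> gives the zero vector, so it needs no separate
  case.\<close>

lemma paired_indicator_in_polydiagonal:
  fixes P :: "'n::finite set set"
  assumes "tagged_partition UNIV P t" "t A = Some B"
  shows "(\<chi> i. of_bool (i \<in> A) - of_bool (i \<in> B)) \<in> polydiagonal P t"
proof -
  note part = tagged_partition_partition_on[OF assms(1)]
  note inv = tagged_partition_sym[OF assms(1)]
  note AB = tagged_partition_mem[OF assms]
  note iff = class_of_eq_iff[OF part AB(1)] class_of_eq_iff[OF part AB(2)]
  have "X = A \<longleftrightarrow> Y = B" "X = B \<longleftrightarrow> Y = A" if "t X = Some Y" for X Y
    using inv assms(2) that by (metis option.inject)+
  then show ?thesis
    unfolding polydiagonal_def by (simp flip: iff)
qed

lemma evenly_tagged_if_sums_eq_0: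
  fixes P :: "'n::finite set set"
  assumes tp: "tagged_partition UNIV P t"
    and sum0: "\<And>x. x \<in> polydiagonal P t \<Longrightarrow> (\<Sum>i\<in>UNIV. x $ i) = 0"
  shows "evenly_tagged P t"
proof -
  have "t A \<noteq> None" if "A \<in> P" for A
  proof
    assume "t A = None"
    \<comment> \<open>The coordinate sum of the indicator is \<open>card A\<close>.\<close>
    from sum0[OF untagged_indicator_in_polydiagonal[OF tp that this]]
    have "A = {}"
      by simp
    with that tagged_partition_partition_on[OF tp] show False
      by (simp add: partition_on_def)
  qed
  moreover have "card A = card B" if "t A = Some B" for A B
    using sum0[OF paired_indicator_in_polydiagonal[OF tp that]]
    by (simp add: sum_subtractf)
  moreover have "dom t \<subseteq> P"
    using tagged_partition_mem(1)[OF tp] by blast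
  ultimately show ?thesis
    unfolding evenly_tagged_def fully_tagged_def by fastforce
qed

text \<open>Any tagged pair would yield coordinates of \<open>v\<close> that cancel. If the pair is
  a single fixed class with one element, these coincide, which is where the assumption for
  \<open>i = j\<close> enters.\<close>

lemma synchrony_if_mem_polydiagonal:
  fixes P :: "'n::finite set set"
  assumes tp: "tagged_partition UNIV P t"
    and "v \<in> polydiagonal P t" "\<forall>i j. v $ i + v $ j \<noteq> 0"
  shows "synchrony P t"
proof (rule ccontr)
  assume "\<not> synchrony P t"
  then obtain A B where AB: "t A = Some B"
    unfolding synchrony_def by fastforce
  note part = tagged_partition_partition_on[OF tp]
  note mem = tagged_partition_mem[OF tp AB]
  obtain i j where "i \<in> A" "j \<in> B"
    using part mem by (metis all_not_in_conv partition_on_def)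
  then have "class_of P i = A" "class_of P j = B"
    using class_of_eqI[OF part] mem by auto
  then have "v $ i = - v $ j"
    using assms(2) AB by (auto simp: polydiagonal_def)
  with assms(3) show False
    by (metis add.left_inverse)
qed

theorem theorem6p3:
  fixes M :: "real ^ 'n ^ 'n" and l :: real and v :: "real ^ 'n"
    and P :: "'n set set" and t :: "'n set \<rightharpoonup> 'n set"
  assumes "\<forall>j. (\<Sum>i\<in>UNIV. M $ i $ j) = l"
    and "geometric_multiplicity M l = 1"
    and "eigenvector M v l"
    and "\<forall>i j. v $ i + v $ j \<noteq> 0"
    and "tagged_partition UNIV P t"
    and "invariant_under M (polydiagonal P t)"
  shows "(synchrony P t \<and> v \<in> polydiagonal P t) \<or>
         (anti_synchrony P t \<and> evenly_tagged P t \<and> v \<notin> polydiagonal P t)"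
proof (cases "v \<in> polydiagonal P t")
  case True
  then show ?thesis
    using synchrony_if_mem_polydiagonal assms(4,5) by blast
next
  case False
  have even: "evenly_tagged P t"
    using invariant_subspace_sum_eq_0[OF assms(1-3) subspace_polydiagonal assms(6) False]
    by (intro evenly_tagged_if_sums_eq_0 assms(5))
  \<comment> \<open>For empty \<open>P\<close> the empty involution would also be fully
    tagged.\<close>
  moreover have "P \<noteq> {}"
    using tagged_partition_partition_on[OF assms(5)] by (auto simp: partition_on_def)
  ultimately have "anti_synchrony P t"
    by (auto simp: evenly_tagged_def fully_tagged_def anti_synchrony_def)
  with even False show ?thesis
    by blast
qed

end
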